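(* The assignment $G\mapsto\mathbf{Pr}(G)$, $\pi\mapsto \mathbf{Pr}(\pi)$, where for a partial homomorphism $\pi\colon G\to H$ of inverse semigroups $\mathbf{Pr}(\pi)\colon\mathbf{Pr}(G)\to\mathbf{Pr}(H)$ is the homomorphism determined by $\mathbf{Pr}(\pi)([g])=[\pi(g)]$ for $g\in G$, is a functor $\mathbf{Pr}\colon\mathrm{PInv}\to\mathrm{Inv}$, and it is left adjoint to the forgetful functor $\mathbf{Fg}\colon\mathrm{Inv}\to\mathrm{PInv}$. That is, for inverse semigroups $G,H$ there is a bijection $$\mathrm{Hom}(\mathbf{Pr}(G),H)\cong\mathrm{PHom}(G,H)$$ natural in $G$ and $H$. The unit of the adjunction is the natural transformation $\iota$ given by $\iota_G\colon G\to\mathbf{Pr}(G)$, $\iota_G(g)=[g]$, and the counit is the natural transformation $\partial$ given by $\partial_G\colon\mathbf{Pr}(G)\to G$, $\partial_G([g])=g$.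
   Context: For an inverse semigroup $G$, $s^*$ denotes the inverse of $s\in G$. A map $\pi\colon G\to H$ between inverse semigroups is a partial homomorphism if for all $s,t\in G$: $\pi(s)\pi(t)\pi(t^* )=\pi(st)\pi(t^* )$, $\pi(s^* )\pi(s)\pi(t)=\pi(s^* )\pi(st)$, and $\pi(s)\pi(s^* )\pi(s)=\pi(s)$. Compositions of partial homomorphisms between inverse semigroups are partial homomorphisms. $\mathrm{Inv}$ is the category of inverse semigroups with homomorphisms as morphisms (hom-sets $\mathrm{Hom}(G,H)$), and $\mathrm{PInv}$ is the category of inverse semigroups with partial homomorphisms as morphisms (hom-sets $\mathrm{PHom}(G,H)$). $\mathbf{Fg}\colon\mathrm{Inv}\to\mathrm{PInv}$ is the identity on objects and regards a homomorphism as a partial homomorphism. $\mathbf{Pr}(G)$ is the universal semigroup with one generator $[s]$ for each $s\in G$ and, for all $s,t\in G$, the relations (i) $[s][t][t^*]=[st][t^*]$; (ii) $[s^*][s][t]=[s^*][st]$; (iii) $[s][s^*][s]=[s]$. It is an inverse semigroup. *)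

theory Defs
  imports "HOL-Library.FuncSet" "HOL-Algebra.Congruence"
begin

section \<open>Inverse semigroups\<close>

record 'a semigrp = "'a partial_object" +
  smult :: "['a, 'a] \<Rightarrow> 'a" (infixl "\<cdot>\<index>" 70)

locale semigrp =
  fixes S :: "('a, 'm) semigrp_scheme" (structure)
  assumes closed: "\<lbrakk>x \<in> carrier S; y \<in> carrier S\<rbrakk> \<Longrightarrow> x \<cdot> y \<in> carrier S"
    and assoc: "\<lbrakk>x \<in> carrier S; y \<in> carrier S; z \<in> carrier S\<rbrakk> \<Longrightarrow> x \<cdot> y \<cdot> z = x \<cdot> (y \<cdot> z)"

definition is_inverse :: "('a, 'm) semigrp_scheme \<Rightarrow> 'a \<Rightarrow> 'a \<Rightarrow> bool" where
  "is_inverse S s t \<longleftrightarrow>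
     t \<in> carrier S \<and> s \<cdot>\<^bsub>S\<^esub> t \<cdot>\<^bsub>S\<^esub> s = s \<and> t \<cdot>\<^bsub>S\<^esub> s \<cdot>\<^bsub>S\<^esub> t = t"

locale inverse_semigrp = semigrp +
  assumes ex1_inverse: "s \<in> carrier S \<Longrightarrow> \<exists>!t. is_inverse S s t"

definition star :: "('a, 'm) semigrp_scheme \<Rightarrow> 'a \<Rightarrow> 'a" where
  "star S s = (THE t. is_inverse S s t)"


section \<open>The hom-sets of the categories Inv and PInv\<close>

text \<open>
  Morphisms are extensional functions on the carrier (\<open>\<rightarrow>\<^sub>E\<close>), so that equality of morphisms is
  equality in HOL. Composition in both categories is \<^const>\<open>compose\<close>.
\<close>

definition Hom :: "('a, 'm) semigrp_scheme \<Rightarrow> ('b, 'n) semigrp_scheme \<Rightarrow> ('a \<Rightarrow> 'b) set" where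
  "Hom G H = {f \<in> carrier G \<rightarrow>\<^sub>E carrier H.
     \<forall>s\<in>carrier G. \<forall>t\<in>carrier G. f (s \<cdot>\<^bsub>G\<^esub> t) = f s \<cdot>\<^bsub>H\<^esub> f t}"

definition PHom :: "('a, 'm) semigrp_scheme \<Rightarrow> ('b, 'n) semigrp_scheme \<Rightarrow> ('a \<Rightarrow> 'b) set" where
  "PHom G H = {p \<in> carrier G \<rightarrow>\<^sub>E carrier H.
     \<forall>s\<in>carrier G. \<forall>t\<in>carrier G.
       p s \<cdot>\<^bsub>H\<^esub> p t \<cdot>\<^bsub>H\<^esub> p (star G t) = p (s \<cdot>\<^bsub>G\<^esub> t) \<cdot>\<^bsub>H\<^esub> p (star G t) \<and>
       p (star G s) \<cdot>\<^bsub>H\<^esub> p s \<cdot>\<^bsub>H\<^esub> p t = p (star G s) \<cdot>\<^bsub>H\<^esub> p (s \<cdot>\<^bsub>G\<^esub> t) \<and>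
       p s \<cdot>\<^bsub>H\<^esub> p (star G s) \<cdot>\<^bsub>H\<^esub> p s = p s}"

definition ident :: "('a, 'm) semigrp_scheme \<Rightarrow> 'a \<Rightarrow> 'a" where
  "ident G = (\<lambda>x\<in>carrier G. x)"

text \<open>
  \<open>comp_mor G g f\<close> is \<open>g \<circ> f\<close>, where \<open>G\<close> is the domain of \<open>f\<close>.
\<close>

abbreviation comp_mor ::
    "('a, 'm) semigrp_scheme \<Rightarrow> ('b \<Rightarrow> 'c) \<Rightarrow> ('a \<Rightarrow> 'b) \<Rightarrow> 'a \<Rightarrow> 'c" where
  "comp_mor G g f \<equiv> compose (carrier G) g f"


section \<open>Semigroups given by generators and relations\<close>

text \<open>
  The free semigroup on \<open>X\<close> consists of the nonempty words over \<open>X\<close>; the presented semigroup is its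
  quotient by the least congruence containing the relations.
\<close>

definition words :: "'a set \<Rightarrow> 'a list set" where
  "words X = lists X - {[]}"

inductive_set generated_cong :: "'a set \<Rightarrow> ('a list \<times> 'a list) set \<Rightarrow> ('a list \<times> 'a list) set"
  for X :: "'a set" and R :: "('a list \<times> 'a list) set"
where
  base: "\<lbrakk>(u, v) \<in> R; u \<in> words X; v \<in> words X\<rbrakk> \<Longrightarrow> (u, v) \<in> generated_cong X R"
| refl: "u \<in> words X \<Longrightarrow> (u, u) \<in> generated_cong X R"
| sym: "(u, v) \<in> generated_cong X R \<Longrightarrow> (v, u) \<in> generated_cong X R"
| trans: "\<lbrakk>(u, v) \<in> generated_cong X R; (v, w) \<in> generated_cong X R\<rbrakk>
    \<Longrightarrow> (u, w) \<in> generated_cong X R"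
| left: "\<lbrakk>(u, v) \<in> generated_cong X R; w \<in> words X\<rbrakk> \<Longrightarrow> (w @ u, w @ v) \<in> generated_cong X R"
| right: "\<lbrakk>(u, v) \<in> generated_cong X R; w \<in> words X\<rbrakk> \<Longrightarrow> (u @ w, v @ w) \<in> generated_cong X R"

definition presented :: "'a set \<Rightarrow> ('a list \<times> 'a list) set \<Rightarrow> 'a list set semigrp" where
  "presented X R =
     \<lparr>carrier = words X // generated_cong X R,
      smult = (\<lambda>A B. \<Union>a\<in>A. \<Union>b\<in>B. generated_cong X R `` {a @ b})\<rparr>"


section \<open>The semigroup Pr(G) and the maps between these semigroups\<close>

definition pr_rels :: "('a, 'm) semigrp_scheme \<Rightarrow> ('a list \<times> 'a list) set" where
  "pr_rels G =
     {([s, t, star G t], [s \<cdot>\<^bsub>G\<^esub> t, star G t]) | s t. s \<in> carrier G \<and> t \<in> carrier G} \<union>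
     {([star G s, s, t], [star G s, s \<cdot>\<^bsub>G\<^esub> t]) | s t. s \<in> carrier G \<and> t \<in> carrier G} \<union>
     {([s, star G s, s], [s]) | s. s \<in> carrier G}"

definition Pr :: "('a, 'm) semigrp_scheme \<Rightarrow> 'a list set semigrp" where
  "Pr G = presented (carrier G) (pr_rels G)"

definition gen :: "('a, 'm) semigrp_scheme \<Rightarrow> 'a \<Rightarrow> 'a list set" where
  "gen G g = generated_cong (carrier G) (pr_rels G) `` {[g]}"

definition Pr_map ::
    "('a, 'm) semigrp_scheme \<Rightarrow> ('b, 'n) semigrp_scheme \<Rightarrow> ('a \<Rightarrow> 'b) \<Rightarrow> 'a list set \<Rightarrow> 'b list set" where
  "Pr_map G H p = (THE f. f \<in> Hom (Pr G) (Pr H) \<and> (\<forall>g\<in>carrier G. f (gen G g) = gen H (p g)))"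

definition unit_map :: "('a, 'm) semigrp_scheme \<Rightarrow> 'a \<Rightarrow> 'a list set" (\<open>\<iota>\<close>) where
  "\<iota> G = (\<lambda>g\<in>carrier G. gen G g)"

definition counit_map :: "('a, 'm) semigrp_scheme \<Rightarrow> 'a list set \<Rightarrow> 'a" (\<open>\<partial>\<close>) where
  "\<partial> G = (THE f. f \<in> Hom (Pr G) G \<and> (\<forall>g\<in>carrier G. f (gen G g) = g))"

text \<open>
  The comparison map \<open>Hom(Pr(G), H) \<rightarrow> PHom(G, H)\<close> whose unit is \<open>\<iota>\<close>. It does not depend on \<open>H\<close>.
\<close>

definition adj :: "('a, 'm) semigrp_scheme \<Rightarrow> ('a list set \<Rightarrow> 'b) \<Rightarrow> 'a \<Rightarrow> 'b" (\<open>\<Phi>\<close>) where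
  "\<Phi> G f = comp_mor G f (\<iota> G)"

end

(*
  Let p be a partial homomorphism from an inverse semigroup into a semigroup generated by its image,
  and write e(s) = p(s) p(s^* ).  The e(s) are commuting idempotents, p(t) e(s) = e(ts) p(t), and
  p(s) p(t) = e(s) p(st), so every element has the form c p(s) with c a product of elements e(r).
  Then p(s^* ) c is an inverse of c p(s), and both products of the two lie in the commutative band
  generated by the e(r); this makes the inverse unique.  Hence Pr(G) is an inverse semigroup.
  Everything else follows from the universal property of the presentation.
*)
theory Submission
  imports Defs
begin

section \<open>Inverse semigroups\<close>

text \<open>In these comments s' is the inverse of s in G. The codomain of p is only known to be a
  semigroup, so nothing about its idempotents may be presupposed: that the \<epsilon> s commute has
  to come out of the axioms of a partial homomorphism and the commuting idempotents of G. Shifting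
  \<epsilon> s through p(t) and then through p(t') yields \<epsilon>(tt's) instead of \<epsilon> s;
  the gap is closed by p(tt'), which \<epsilon> t absorbs on either side. Uniqueness of inverses is
  then obtained without first describing the idempotents of Pr(G): one inverse per element, with
  both products in a commuting set, already forces every idempotent into that set. That Pr(G) is
  inverse also matters for the bijection, since a homomorphism on Pr(G) precomposed with \<iota> is
  a composite of partial homomorphisms with middle object Pr(G).\<close>

context semigrp
begin

lemma mult_left_commuteI:
  assumes "x \<in> carrier S" "y \<in> carrier S" "z \<in> carrier S" "x \<cdot> y = y \<cdot> x"
  shows "x \<cdot> (y \<cdot> z) = y \<cdot> (x \<cdot> z)"
  using assms by (metis assoc)

lemma idem_of_is_inverse:
  assumes "s \<in> carrier S" "is_inverse S s t"
  shows "s \<cdot> t \<cdot> (s \<cdot> t) = s \<cdot> t" and "t \<cdot> s \<cdot> (t \<cdot> s) = t \<cdot> s"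
  using assms unfolding is_inverse_def by (metis closed assoc)+

text \<open>
  If \<open>e\<close> is idempotent with inverse \<open>f\<close>, then \<open>f = (f e) (e f) = (e f) (f e)\<close>, which forces
  \<open>e f = f = f e\<close> and so \<open>e = f = e f \<in> C\<close>. Hence all idempotents commute.
\<close>

lemma inverse_semigrpI:
  assumes C: "\<And>c d. c \<in> C \<Longrightarrow> d \<in> C \<Longrightarrow> c \<cdot> d = d \<cdot> c"
    and ex: "\<And>x. x \<in> carrier S \<Longrightarrow> \<exists>y. is_inverse S x y \<and> x \<cdot> y \<in> C \<and> y \<cdot> x \<in> C"
  shows "inverse_semigrp S"
proof
  have idem_C: "e \<in> C" if e: "e \<in> carrier S" "e \<cdot> e = e" for e
  proof -
    obtain f where f: "is_inverse S e f" and fC: "e \<cdot> f \<in> C" "f \<cdot> e \<in> C"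
      using ex e by blast
    have fc: "f \<in> carrier S" and efe: "e \<cdot> f \<cdot> e = e" and fef: "f \<cdot> e \<cdot> f = f"
      using f by (auto simp: is_inverse_def)
    have f_eq: "f = f \<cdot> e \<cdot> (e \<cdot> f)"
      using e fc fef by (metis assoc closed)
    have ff: "f = e \<cdot> f \<cdot> (f \<cdot> e)"
      using f_eq C[OF fC(1) fC(2)] by simp
    then have "f = e \<cdot> f" and "f = f \<cdot> e"
      using e fc by (metis assoc closed)+
    then have "e = f"
      using efe by metis
    then show ?thesis using fC e by simp
  qed
  fix s assume s: "s \<in> carrier S"
  show "\<exists>!t. is_inverse S s t"
  proof (rule ex_ex1I)
    show "\<exists>t. is_inverse S s t" using ex s by blast
  next
    fix t u assume t: "is_inverse S s t" and u: "is_inverse S s u"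
    have c: "t \<in> carrier S" "u \<in> carrier S"
      and tt: "s \<cdot> t \<cdot> s = s" "t \<cdot> s \<cdot> t = t" and uu: "s \<cdot> u \<cdot> s = s" "u \<cdot> s \<cdot> u = u"
      using t u by (auto simp: is_inverse_def)
    \<comment> \<open>All four products are idempotent, hence in C. Commuting s t with s u reduces t
      to t s u; commuting t s with u s then reduces t s u to u.\<close>
    have "s \<cdot> t \<in> C" "s \<cdot> u \<in> C" "t \<cdot> s \<in> C" "u \<cdot> s \<in> C"
      using idem_of_is_inverse[OF s t] idem_of_is_inverse[OF s u] c s by (auto intro!: idem_C closed)
    then have st: "s \<cdot> t \<cdot> (s \<cdot> u) = s \<cdot> u \<cdot> (s \<cdot> t)" and ts: "t \<cdot> s \<cdot> (u \<cdot> s) = u \<cdot> s \<cdot> (t \<cdot> s)"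
      using C by blast+
    have "t = t \<cdot> (s \<cdot> u \<cdot> (s \<cdot> t))"
      using tt uu c s by (metis assoc closed)
    also have "\<dots> = t \<cdot> (s \<cdot> t \<cdot> (s \<cdot> u))" using st by simp
    also have "\<dots> = t \<cdot> s \<cdot> u" using tt c s by (metis assoc closed)
    also have "\<dots> = t \<cdot> s \<cdot> (u \<cdot> s) \<cdot> u" using uu c s by (metis assoc closed)
    also have "\<dots> = u \<cdot> s \<cdot> (t \<cdot> s) \<cdot> u" using ts by simp
    also have "\<dots> = u" using tt uu c s by (metis assoc closed)
    finally show "t = u" .
  qed
qed

end

section \<open>Commuting idempotents and the involution of an inverse semigroup\<close>

context inverse_semigrp
begin

lemma star_is_inverse: "s \<in> carrier S \<Longrightarrow> is_inverse S s (star S s)"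
  unfolding star_def by (rule theI'[OF ex1_inverse])

lemma star_closed [simp]: "s \<in> carrier S \<Longrightarrow> star S s \<in> carrier S"
  and mult_star_mult: "s \<in> carrier S \<Longrightarrow> s \<cdot> star S s \<cdot> s = s"
  and star_mult_star: "s \<in> carrier S \<Longrightarrow> star S s \<cdot> s \<cdot> star S s = star S s"
  by (simp_all add: star_is_inverse[unfolded is_inverse_def])

lemma star_unique: "s \<in> carrier S \<Longrightarrow> is_inverse S s t \<Longrightarrow> star S s = t"
  using ex1_inverse star_is_inverse by blast

lemma star_star [simp]: "s \<in> carrier S \<Longrightarrow> star S (star S s) = s"
  by (rule star_unique) (auto simp: is_inverse_def mult_star_mult star_mult_star)

text \<open>Let x be the inverse of e f. Then f x e is another one, so x = f x e by uniqueness, and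
  this form makes x idempotent. An idempotent is its own inverse, so x equals its inverse e
  f.\<close>

lemma idem_mult_idem:
  assumes e: "e \<in> carrier S" "e \<cdot> e = e" and f: "f \<in> carrier S" "f \<cdot> f = f"
  shows "e \<cdot> f \<cdot> (e \<cdot> f) = e \<cdot> f"
proof -
  define x where "x = star S (e \<cdot> f)"
  have ef: "e \<cdot> f \<in> carrier S" using e f closed by simp
  have x: "x \<in> carrier S" "e \<cdot> f \<cdot> x \<cdot> (e \<cdot> f) = e \<cdot> f" "x \<cdot> (e \<cdot> f) \<cdot> x = x"
    using ef by (simp_all add: x_def mult_star_mult star_mult_star)
  note simps = assoc closed e f x(1)
  have ee: "e \<cdot> (e \<cdot> y) = e \<cdot> y" and ff: "f \<cdot> (f \<cdot> y) = f \<cdot> y" if "y \<in> carrier S" for y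
    using that e f by (metis assoc)+
  have xx: "x \<cdot> (e \<cdot> (f \<cdot> (x \<cdot> y))) = x \<cdot> y" if "y \<in> carrier S" for y
    using that x e f by (metis assoc closed)
  have "is_inverse S (e \<cdot> f) (f \<cdot> x \<cdot> e)"
    unfolding is_inverse_def using x(2) by (simp add: simps ee ff xx)
  then have x_eq: "x = f \<cdot> x \<cdot> e"
    unfolding x_def by (rule star_unique[OF ef])
  have "x \<cdot> x = f \<cdot> x \<cdot> e \<cdot> (f \<cdot> x \<cdot> e)" by (simp flip: x_eq)
  also have "\<dots> = f \<cdot> x \<cdot> e" by (simp add: simps xx)
  finally have "x \<cdot> x = x" by (simp flip: x_eq)
  then have "star S x = x"
    using x(1) by (intro star_unique) (simp_all add: is_inverse_def)
  then have "x = e \<cdot> f" using star_star[OF ef] by (simp add: x_def)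
  with \<open>x \<cdot> x = x\<close> show ?thesis by simp
qed

text \<open>As e f and f e are both idempotent, each of them is an inverse of e f.\<close>

lemma idem_commute:
  assumes e: "e \<in> carrier S" "e \<cdot> e = e" and f: "f \<in> carrier S" "f \<cdot> f = f"
  shows "e \<cdot> f = f \<cdot> e"
proof -
  have ef: "e \<cdot> f \<in> carrier S" "e \<cdot> f \<cdot> (e \<cdot> f) = e \<cdot> f" "f \<cdot> e \<cdot> (f \<cdot> e) = f \<cdot> e"
    using idem_mult_idem[OF e f] idem_mult_idem[OF f e] e f closed by simp_all
  have ee: "e \<cdot> (e \<cdot> y) = e \<cdot> y" and ff: "f \<cdot> (f \<cdot> y) = f \<cdot> y" if "y \<in> carrier S" for y
    using that e f by (metis assoc)+
  have "is_inverse S (e \<cdot> f) (e \<cdot> f)" using ef by (simp add: is_inverse_def)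
  moreover have "is_inverse S (e \<cdot> f) (f \<cdot> e)"
    using ef e f by (simp add: is_inverse_def assoc closed ee ff)
  ultimately show ?thesis using star_unique[OF ef(1)] by metis
qed

lemma mult_star_commute:
  assumes "s \<in> carrier S" "t \<in> carrier S"
  shows "s \<cdot> star S s \<cdot> (t \<cdot> star S t) = t \<cdot> star S t \<cdot> (s \<cdot> star S s)"
  using assms idem_of_is_inverse(1)[OF _ star_is_inverse]
  by (intro idem_commute) (simp_all add: closed)

lemma star_mult:
  assumes s: "s \<in> carrier S" and t: "t \<in> carrier S"
  shows "star S (s \<cdot> t) = star S t \<cdot> star S s"
proof (rule star_unique)
  have comm: "t \<cdot> star S t \<cdot> (star S s \<cdot> s) = star S s \<cdot> s \<cdot> (t \<cdot> star S t)"
    using mult_star_commute[of t "star S s"] s t by simp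
  have "s \<cdot> t \<cdot> (star S t \<cdot> star S s) \<cdot> (s \<cdot> t) = s \<cdot> (t \<cdot> star S t \<cdot> (star S s \<cdot> s)) \<cdot> t"
    using s t by (simp add: assoc closed)
  also have "\<dots> = s \<cdot> star S s \<cdot> s \<cdot> (t \<cdot> star S t \<cdot> t)"
    unfolding comm using s t by (simp add: assoc closed)
  finally have 1: "s \<cdot> t \<cdot> (star S t \<cdot> star S s) \<cdot> (s \<cdot> t) = s \<cdot> t"
    using s t by (simp add: mult_star_mult)
  have "star S t \<cdot> star S s \<cdot> (s \<cdot> t) \<cdot> (star S t \<cdot> star S s) =
      star S t \<cdot> (star S s \<cdot> s \<cdot> (t \<cdot> star S t)) \<cdot> star S s"
    using s t by (simp add: assoc closed)
  also have "\<dots> = star S t \<cdot> t \<cdot> star S t \<cdot> (star S s \<cdot> s \<cdot> star S s)"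
    unfolding comm[symmetric] using s t by (simp add: assoc closed)
  finally have 2: "star S t \<cdot> star S s \<cdot> (s \<cdot> t) \<cdot> (star S t \<cdot> star S s) = star S t \<cdot> star S s"
    using s t by (simp add: star_mult_star)
  show "is_inverse S (s \<cdot> t) (star S t \<cdot> star S s)"
    using 1 2 s t by (simp add: is_inverse_def closed)
qed (use s t closed in simp)

end

section \<open>Homomorphisms and partial homomorphisms\<close>

lemma Hom_closed: "f \<in> Hom G H \<Longrightarrow> x \<in> carrier G \<Longrightarrow> f x \<in> carrier H"
  and Hom_mult: "f \<in> Hom G H \<Longrightarrow> x \<in> carrier G \<Longrightarrow> y \<in> carrier G \<Longrightarrow>
    f (x \<cdot>\<^bsub>G\<^esub> y) = f x \<cdot>\<^bsub>H\<^esub> f y"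
  by (auto simp: Hom_def)

lemma Hom_extensional: "f \<in> Hom G H \<Longrightarrow> f \<in> extensional (carrier G)"
  by (auto simp: Hom_def PiE_def)

lemma PHom_closed: "p \<in> PHom G H \<Longrightarrow> x \<in> carrier G \<Longrightarrow> p x \<in> carrier H"
  by (auto simp: PHom_def)

lemma PHom_extensional: "p \<in> PHom G H \<Longrightarrow> p \<in> extensional (carrier G)"
  by (auto simp: PHom_def PiE_def)

lemma compose_in_Hom:
  assumes "semigrp G" "f \<in> Hom G H" "g \<in> Hom H K"
  shows "comp_mor G g f \<in> Hom G K"
  using Hom_closed[OF assms(2)] Hom_closed[OF assms(3)] Hom_mult[OF assms(2)] Hom_mult[OF assms(3)]
  by (auto simp: Hom_def compose_def semigrp.closed[OF assms(1)])

lemma ident_in_Hom: "semigrp G \<Longrightarrow> ident G \<in> Hom G G"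
  by (auto simp: Hom_def ident_def semigrp.closed)

lemma ident_apply: "x \<in> carrier G \<Longrightarrow> ident G x = x"
  by (simp add: ident_def)

lemma Hom_subset_PHom:
  assumes "inverse_semigrp G" "semigrp H"
  shows "Hom G H \<subseteq> PHom G H"
proof
  interpret G: inverse_semigrp G by fact
  interpret H: semigrp H by fact
  fix f assume f: "f \<in> Hom G H"
  show "f \<in> PHom G H"
    unfolding PHom_def
  proof (intro CollectI conjI ballI)
    show "f \<in> carrier G \<rightarrow>\<^sub>E carrier H" using f by (simp add: Hom_def)
    fix s t assume s: "s \<in> carrier G" and t: "t \<in> carrier G"
    note [simp] = s t Hom_mult[OF f] Hom_closed[OF f] G.closed
    show "f s \<cdot>\<^bsub>H\<^esub> f t \<cdot>\<^bsub>H\<^esub> f (star G t) = f (s \<cdot>\<^bsub>G\<^esub> t) \<cdot>\<^bsub>H\<^esub> f (star G t)"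
      by simp
    show "f (star G s) \<cdot>\<^bsub>H\<^esub> f s \<cdot>\<^bsub>H\<^esub> f t = f (star G s) \<cdot>\<^bsub>H\<^esub> f (s \<cdot>\<^bsub>G\<^esub> t)"
      by (simp add: H.assoc)
    have "f (s \<cdot>\<^bsub>G\<^esub> star G s \<cdot>\<^bsub>G\<^esub> s) = f s" using G.mult_star_mult[OF s] by simp
    then show "f s \<cdot>\<^bsub>H\<^esub> f (star G s) \<cdot>\<^bsub>H\<^esub> f s = f s" by simp
  qed
qed

text \<open>The codomain is a plain semigroup because the locale is to be interpreted with S = Pr(G)
  before Pr(G) is known to be inverse.\<close>

locale partial_hom = G: inverse_semigrp G + S: semigrp S
  for G :: "('a, 'm) semigrp_scheme" and S :: "('b, 'n) semigrp_scheme" +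
  fixes p :: "'a \<Rightarrow> 'b"
  assumes p: "p \<in> PHom G S"
begin

abbreviation domain_mult (infixl "\<otimes>" 70) where "x \<otimes> y \<equiv> x \<cdot>\<^bsub>G\<^esub> y"
abbreviation codomain_mult (infixl "\<odot>" 70) where "x \<odot> y \<equiv> x \<cdot>\<^bsub>S\<^esub> y"

section \<open>Commutation rules for p and the \<epsilon> s\<close>

definition \<epsilon> where "\<epsilon> s = p s \<odot> p (star G s)"

lemma p_closed [simp]: "s \<in> carrier G \<Longrightarrow> p s \<in> carrier S"
  using p by (rule PHom_closed)

lemma \<epsilon>_closed [simp]: "s \<in> carrier G \<Longrightarrow> \<epsilon> s \<in> carrier S"
  by (simp add: \<epsilon>_def S.closed)

lemma p_mult_right:
  "s \<in> carrier G \<Longrightarrow> t \<in> carrier G \<Longrightarrow> p s \<odot> p t \<odot> p (star G t) = p (s \<otimes> t) \<odot> p (star G t)"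
  and p_mult_left:
  "s \<in> carrier G \<Longrightarrow> t \<in> carrier G \<Longrightarrow> p (star G s) \<odot> p s \<odot> p t = p (star G s) \<odot> p (s \<otimes> t)"
  and p_regular: "s \<in> carrier G \<Longrightarrow> p s \<odot> p (star G s) \<odot> p s = p s"
  using p by (auto simp: PHom_def)

lemma p_star_is_inverse: "s \<in> carrier G \<Longrightarrow> is_inverse S (p s) (p (star G s))"
  using p_regular[of s] p_regular[of "star G s"] by (simp add: is_inverse_def)

lemma p_mult_\<epsilon>:
  "s \<in> carrier G \<Longrightarrow> t \<in> carrier G \<Longrightarrow> p s \<odot> \<epsilon> t = p (s \<otimes> t) \<odot> p (star G t)"
  using p_mult_right[of s t] by (simp add: \<epsilon>_def S.assoc)

lemma \<epsilon>_mult_p: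
  "s \<in> carrier G \<Longrightarrow> t \<in> carrier G \<Longrightarrow> \<epsilon> s \<odot> p t = p s \<odot> p (star G s \<otimes> t)"
  using p_mult_left[of "star G s" t] by (simp add: \<epsilon>_def)

lemma \<epsilon>_mult_self [simp]: "s \<in> carrier G \<Longrightarrow> \<epsilon> s \<odot> p s = p s"
  by (simp add: \<epsilon>_def p_regular)

lemma \<epsilon>_idem [simp]: "s \<in> carrier G \<Longrightarrow> \<epsilon> s \<odot> \<epsilon> s = \<epsilon> s"
  by (metis \<epsilon>_def \<epsilon>_mult_self S.assoc \<epsilon>_closed p_closed G.star_closed)

text \<open>The axioms rewrite a product of two values only next to a third one; regularity of p(s)
  supplies the missing factor p(s').\<close>

lemma p_mult_p:
  assumes s: "s \<in> carrier G" and t: "t \<in> carrier G"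
  shows "p s \<odot> p t = \<epsilon> s \<odot> p (s \<otimes> t)"
proof -
  have "p s \<odot> p t = p s \<odot> p (star G s) \<odot> p s \<odot> p t" using p_regular s by simp
  also have "\<dots> = p s \<odot> (p (star G s) \<odot> p s \<odot> p t)" using s t by (simp add: S.assoc S.closed)
  finally show ?thesis
    using p_mult_left[OF s t] s t by (simp add: \<epsilon>_def S.assoc G.closed)
qed

text \<open>Both sides equal p(ts) p((ts)' t): the left side produces tss' in place of t, and (ts)'
  absorbs the difference because (ts)' t s s' = (ts)' t in G.\<close>

lemma p_\<epsilon>_commute:
  assumes s: "s \<in> carrier G" and t: "t \<in> carrier G"
  shows "p t \<odot> \<epsilon> s = \<epsilon> (t \<otimes> s) \<odot> p t"
proof -
  let ?s = "star G s" and ?t = "star G t" and ?u = "star G (t \<otimes> s)"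
  have ts: "t \<otimes> s \<in> carrier G" using s t G.closed by simp
  have "?u \<otimes> (t \<otimes> s \<otimes> ?s) = ?s \<otimes> (?t \<otimes> t \<otimes> (s \<otimes> ?s))"
    using s t by (simp add: G.star_mult G.assoc G.closed)
  also have "\<dots> = ?s \<otimes> (s \<otimes> ?s \<otimes> (?t \<otimes> t))"
    using G.mult_star_commute[of ?t s] s t by simp
  also have "\<dots> = ?s \<otimes> s \<otimes> ?s \<otimes> (?t \<otimes> t)"
    using s t by (simp add: G.assoc G.closed)
  also have "\<dots> = ?u \<otimes> t"
    unfolding G.star_mult_star[OF s] using s t by (simp add: G.star_mult G.assoc G.closed)
  finally have u: "?u \<otimes> (t \<otimes> s \<otimes> ?s) = ?u \<otimes> t" .
  have "p t \<odot> \<epsilon> s = p (t \<otimes> s) \<odot> p ?s" using p_mult_\<epsilon> s t by simp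
  also have "\<dots> = \<epsilon> (t \<otimes> s) \<odot> p (t \<otimes> s \<otimes> ?s)" using p_mult_p[OF ts] s by simp
  also have "\<dots> = \<epsilon> (t \<otimes> s) \<odot> p t" using \<epsilon>_mult_p[OF ts] u s t ts by (simp add: G.closed)
  finally show ?thesis .
qed

text \<open>The mirror image of \<open>p_\<epsilon>_commute\<close>, under reversal of products and
  passage to inverses in G.\<close>

lemma \<epsilon>_p_commute:
  assumes s: "s \<in> carrier G" and t: "t \<in> carrier G"
  shows "\<epsilon> s \<odot> p t = p t \<odot> \<epsilon> (star G t \<otimes> s)"
proof -
  let ?s = "star G s" and ?t = "star G t"
  let ?u = "?s \<otimes> t"
  have u: "?u \<in> carrier G" "star G ?u = ?t \<otimes> s" "?t \<otimes> s \<in> carrier G" "star G (?t \<otimes> s) = ?u"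
    using s t by (simp_all add: G.closed G.star_mult)
  have "s \<otimes> ?u \<otimes> (?t \<otimes> s) = s \<otimes> ?s \<otimes> (t \<otimes> ?t) \<otimes> s"
    using s t by (simp add: G.assoc G.closed)
  also have "\<dots> = t \<otimes> ?t \<otimes> (s \<otimes> ?s) \<otimes> s" using G.mult_star_commute[OF s t] by simp
  also have "\<dots> = t \<otimes> ?t \<otimes> (s \<otimes> ?s \<otimes> s)" using s t by (simp add: G.assoc G.closed)
  also have "\<dots> = t \<otimes> (?t \<otimes> s)" using G.mult_star_mult[OF s] s t by (simp add: G.assoc G.closed)
  finally have eq: "s \<otimes> ?u \<otimes> (?t \<otimes> s) = t \<otimes> (?t \<otimes> s)" .
  have "\<epsilon> s \<odot> p t = p s \<odot> p ?u" using \<epsilon>_mult_p s t by simp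
  \<comment> \<open>Regularity at u = s't creates p(u') p(u), so that the right-hand axiom applies
    twice, first to u and then to u'; the argument becomes s u u' = tt's.\<close>
  also have "\<dots> = p s \<odot> (p ?u \<odot> p (star G ?u) \<odot> p ?u)" using p_regular[OF u(1)] by simp
  also have "\<dots> = p s \<odot> p ?u \<odot> p (star G ?u) \<odot> p ?u"
    using s u(1) by (simp add: S.assoc S.closed)
  also have "\<dots> = p (s \<otimes> ?u) \<odot> p (?t \<otimes> s) \<odot> p (star G (?t \<otimes> s))"
    using p_mult_right[OF s u(1)] u by simp
  also have "\<dots> = p (s \<otimes> ?u \<otimes> (?t \<otimes> s)) \<odot> p (star G (?t \<otimes> s))"
    using p_mult_right[of "s \<otimes> ?u" "?t \<otimes> s"] p_mult_right[of "s \<otimes> ?u" "star G ?u"] u s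
    by (simp add: G.closed)
  also have "\<dots> = p t \<odot> \<epsilon> (?t \<otimes> s)"
    unfolding eq using p_mult_\<epsilon>[OF t u(3)] by simp
  finally show ?thesis .
qed

text \<open>Put e = tt'. Passing \<epsilon> s through both factors of \<epsilon> t gives
  \<epsilon>(es), and a p(e) taken out of \<epsilon> t turns this back into \<epsilon> s. From the
  right this yields \<epsilon> t \<epsilon> s = p(e) \<epsilon> s \<epsilon> t, from the left
  \<epsilon> s \<epsilon> t = \<epsilon> t \<epsilon> s p(e). By the second equation p(e) fixes
  \<epsilon> s \<epsilon> t from the left, so the first is commutativity.\<close>

lemma \<epsilon>_commute:
  assumes s: "s \<in> carrier G" and t: "t \<in> carrier G"
  shows "\<epsilon> s \<odot> \<epsilon> t = \<epsilon> t \<odot> \<epsilon> s"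
proof -
  let ?t = "star G t"
  let ?e = "t \<otimes> ?t"
  have c: "?t \<in> carrier G" "?e \<in> carrier G" "?e \<otimes> s \<in> carrier G" "?t \<otimes> s \<in> carrier G"
    using s t by (simp_all add: G.closed)
  have e: "star G ?e = ?e" using t by (simp add: G.star_mult)
  have et: "p ?e \<odot> \<epsilon> t = \<epsilon> t"
    using p_mult_\<epsilon>[OF c(2) t] t by (simp add: G.mult_star_mult \<epsilon>_def)
  have te: "\<epsilon> t \<odot> p ?e = \<epsilon> t"
  proof -
    have "?t \<otimes> ?e = ?t" using G.star_mult_star[OF t] t by (simp add: G.assoc)
    then show ?thesis using \<epsilon>_mult_p[OF t c(2)] by (simp add: \<epsilon>_def)
  qed
  have "\<epsilon> t \<odot> \<epsilon> s = p t \<odot> (p ?t \<odot> \<epsilon> s)" using s t by (simp add: \<epsilon>_def S.assoc S.closed)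
  also have "\<dots> = p t \<odot> \<epsilon> (?t \<otimes> s) \<odot> p ?t"
    using p_\<epsilon>_commute[OF s c(1)] c t by (simp add: S.assoc)
  also have "\<dots> = \<epsilon> (?e \<otimes> s) \<odot> \<epsilon> t"
    using p_\<epsilon>_commute[OF c(4) t] c s t by (simp add: S.assoc \<epsilon>_def[of t] G.assoc)
  also have "\<dots> = \<epsilon> (?e \<otimes> s) \<odot> p ?e \<odot> \<epsilon> t" using et c t by (simp add: S.assoc)
  also have "\<dots> = p ?e \<odot> \<epsilon> s \<odot> \<epsilon> t" using p_\<epsilon>_commute[OF s c(2)] by simp
  finally have 1: "\<epsilon> t \<odot> \<epsilon> s = p ?e \<odot> (\<epsilon> s \<odot> \<epsilon> t)" using c s t by (simp add: S.assoc)
  have "\<epsilon> s \<odot> \<epsilon> t = \<epsilon> s \<odot> p t \<odot> p ?t" using s t by (simp add: \<epsilon>_def[of t] S.assoc)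
  also have "\<dots> = p t \<odot> (\<epsilon> (?t \<otimes> s) \<odot> p ?t)"
    using \<epsilon>_p_commute[OF s t] c t by (simp add: S.assoc)
  also have "\<dots> = \<epsilon> t \<odot> \<epsilon> (?e \<otimes> s)"
    using \<epsilon>_p_commute[OF c(4) c(1)] c s t by (simp add: S.assoc \<epsilon>_def[of t] G.assoc)
  also have "\<dots> = \<epsilon> t \<odot> (p ?e \<odot> \<epsilon> (?e \<otimes> s))" using te c t by (simp flip: S.assoc)
  also have "\<dots> = \<epsilon> t \<odot> (\<epsilon> s \<odot> p ?e)" using \<epsilon>_p_commute[OF s c(2)] e by simp
  finally have 2: "\<epsilon> s \<odot> \<epsilon> t = \<epsilon> t \<odot> (\<epsilon> s \<odot> p ?e)" .
  have "p ?e \<odot> (\<epsilon> s \<odot> \<epsilon> t) = p ?e \<odot> \<epsilon> t \<odot> (\<epsilon> s \<odot> p ?e)"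
    unfolding 2 using c s t by (simp add: S.assoc S.closed)
  also have "\<dots> = \<epsilon> s \<odot> \<epsilon> t" using et 2 by simp
  finally show ?thesis using 1 by simp
qed

section \<open>The commutative band generated by the \<epsilon> s\<close>

inductive_set band where
  base: "s \<in> carrier G \<Longrightarrow> \<epsilon> s \<in> band"
| step: "s \<in> carrier G \<Longrightarrow> c \<in> band \<Longrightarrow> \<epsilon> s \<odot> c \<in> band"

lemma band_closed [simp]: "c \<in> band \<Longrightarrow> c \<in> carrier S"
  by (induction rule: band.induct) (auto simp: S.closed)

lemma \<epsilon>_band_commute: "c \<in> band \<Longrightarrow> s \<in> carrier G \<Longrightarrow> \<epsilon> s \<odot> c = c \<odot> \<epsilon> s"
proof (induction rule: band.induct)
  case (step t c)
  have "\<epsilon> s \<odot> (\<epsilon> t \<odot> c) = \<epsilon> t \<odot> (\<epsilon> s \<odot> c)"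
    using step by (intro S.mult_left_commuteI \<epsilon>_commute) auto
  then show ?case using step by (simp add: S.assoc)
qed (simp add: \<epsilon>_commute)

lemma band_commute: "c \<in> band \<Longrightarrow> d \<in> band \<Longrightarrow> c \<odot> d = d \<odot> c"
proof (induction rule: band.induct)
  case (step t c)
  have "\<epsilon> t \<odot> (d \<odot> c) = d \<odot> (\<epsilon> t \<odot> c)"
    using step by (intro S.mult_left_commuteI \<epsilon>_band_commute) auto
  then show ?case using step by (simp add: S.assoc)
qed (simp add: \<epsilon>_band_commute)

lemma band_mult: "c \<in> band \<Longrightarrow> d \<in> band \<Longrightarrow> c \<odot> d \<in> band"
  by (induction rule: band.induct) (simp_all add: band.step S.assoc)

lemma band_idem: "c \<in> band \<Longrightarrow> c \<odot> c = c"
proof (induction rule: band.induct)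
  case (step t c)
  have "\<epsilon> t \<odot> c \<odot> (\<epsilon> t \<odot> c) = \<epsilon> t \<odot> (c \<odot> (\<epsilon> t \<odot> c))"
    using step by (simp add: S.assoc S.closed)
  also have "\<dots> = \<epsilon> t \<odot> (\<epsilon> t \<odot> (c \<odot> c))"
    using step by (subst S.mult_left_commuteI) (auto simp: \<epsilon>_band_commute)
  also have "\<dots> = \<epsilon> t \<odot> c" using step by (simp flip: S.assoc)
  finally show ?case .
qed simp

text \<open>The witness d is c with every factor \<epsilon> t replaced by \<epsilon>(st). It is read
  off a factorization of c, hence the existential form.\<close>

lemma p_band_commute:
  assumes "c \<in> band" "s \<in> carrier G"
  shows "\<exists>d\<in>band. p s \<odot> c = d \<odot> p s"
  using assms
proof (induction rule: band.induct)
  case (base t)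
  then show ?case using p_\<epsilon>_commute by (auto intro!: bexI band.base G.closed)
next
  case (step t c)
  then obtain d where d: "d \<in> band" "p s \<odot> c = d \<odot> p s" by auto
  have "p s \<odot> (\<epsilon> t \<odot> c) = p s \<odot> \<epsilon> t \<odot> c" using step by (simp add: S.assoc)
  also have "\<dots> = \<epsilon> (s \<otimes> t) \<odot> (p s \<odot> c)"
    using step p_\<epsilon>_commute by (simp add: S.assoc G.closed)
  also have "\<dots> = \<epsilon> (s \<otimes> t) \<odot> d \<odot> p s" using step d by (simp add: S.assoc G.closed)
  finally show ?case using d step by (auto intro!: bexI band.step G.closed)
qed

section \<open>Normal forms and their inverses\<close>

definition normal_forms where "normal_forms = {c \<odot> p s | c s. c \<in> band \<and> s \<in> carrier G}"

text \<open>There is no empty product in \<open>band\<close>, so \<epsilon> s serves as the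
  coefficient of p(s).\<close>

lemma p_normal_form: "s \<in> carrier G \<Longrightarrow> p s \<in> normal_forms"
  unfolding normal_forms_def by (auto intro!: exI[of _ "\<epsilon> s"] exI[of _ s] band.base)

text \<open>Left multiplication by values of p suffices for generation, since words grow by
  prefixing letters. The coefficient is carried across p(s), and the two values of p then merge at
  the cost of one more \<epsilon> s.\<close>

lemma p_mult_normal_form:
  assumes s: "s \<in> carrier G" and x: "x \<in> normal_forms"
  shows "p s \<odot> x \<in> normal_forms"
proof -
  obtain c t where c: "c \<in> band" and t: "t \<in> carrier G" and x: "x = c \<odot> p t"
    using x by (auto simp: normal_forms_def)
  obtain d where d: "d \<in> band" "p s \<odot> c = d \<odot> p s" using p_band_commute[OF c s] by blast
  have "p s \<odot> x = p s \<odot> c \<odot> p t" using c s t x by (simp add: S.assoc)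
  also have "\<dots> = d \<odot> \<epsilon> s \<odot> p (s \<otimes> t)"
    using d s t p_mult_p[OF s t] by (simp add: S.assoc G.closed)
  finally show ?thesis
    unfolding normal_forms_def using d s t band_mult band.base G.closed by blast
qed

lemma normal_form_inverse:
  assumes "x \<in> normal_forms"
  shows "\<exists>y. is_inverse S x y \<and> x \<odot> y \<in> band \<and> y \<odot> x \<in> band"
proof -
  obtain c s where c: "c \<in> band" and s: "s \<in> carrier G" and x: "x = c \<odot> p s"
    using assms by (auto simp: normal_forms_def)
  let ?y = "p (star G s) \<odot> c"
  have "x \<odot> ?y = c \<odot> (\<epsilon> s \<odot> c)"
    using c s by (simp add: x \<epsilon>_def S.assoc S.closed)
  also have "\<dots> = \<epsilon> s \<odot> c"
    using c s band_idem by (simp add: \<epsilon>_band_commute flip: S.assoc)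
  finally have xy: "x \<odot> ?y = \<epsilon> s \<odot> c" .
  \<comment> \<open>In the product in the other order c stands between p(s') and p(s); moving it to
    the front leaves \<epsilon>(s').\<close>
  obtain d where d: "d \<in> band" "p (star G s) \<odot> c = d \<odot> p (star G s)"
    using p_band_commute[OF c G.star_closed[OF s]] by blast
  have "?y \<odot> x = p (star G s) \<odot> (c \<odot> c) \<odot> p s"
    using c s by (simp add: x S.assoc S.closed)
  also have "\<dots> = d \<odot> \<epsilon> (star G s)"
    using d c s by (simp add: band_idem \<epsilon>_def S.assoc S.closed)
  finally have yx: "?y \<odot> x = d \<odot> \<epsilon> (star G s)" .
  have "x \<odot> ?y \<odot> x = c \<odot> \<epsilon> s \<odot> (c \<odot> p s)"
    using xy x \<epsilon>_band_commute[OF c s] by simp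
  also have "\<dots> = c \<odot> c \<odot> (\<epsilon> s \<odot> p s)"
    using c s \<epsilon>_band_commute[OF c s] by (metis S.assoc S.closed \<epsilon>_closed band_closed p_closed)
  finally have 1: "x \<odot> ?y \<odot> x = x" using c s by (simp add: band_idem x)
  have "p (star G s) \<odot> \<epsilon> s = p (star G s)"
    using p_regular[of "star G s"] s by (simp add: \<epsilon>_def S.assoc)
  moreover have "?y \<odot> x \<odot> ?y = ?y \<odot> (x \<odot> ?y)"
    using c s by (simp add: x S.assoc S.closed)
  moreover have "\<dots> = p (star G s) \<odot> (c \<odot> (\<epsilon> s \<odot> c))"
    using xy c s by (simp add: S.assoc S.closed)
  moreover have "\<dots> = p (star G s) \<odot> (\<epsilon> s \<odot> c)"
    using c s band_idem by (simp add: \<epsilon>_band_commute flip: S.assoc)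
  ultimately have "?y \<odot> x \<odot> ?y = ?y" using c s by (metis S.assoc \<epsilon>_closed band_closed p_closed G.star_closed)
  with 1 have "is_inverse S x ?y" using c s by (simp add: is_inverse_def S.closed)
  moreover have "x \<odot> ?y \<in> band" unfolding xy using c s by (intro band.step)
  moreover have "?y \<odot> x \<in> band" unfolding yx using d s by (intro band_mult band.base) auto
  ultimately show ?thesis by blast
qed

lemma inverse_semigrp_of_generated:
  assumes "carrier S \<subseteq> normal_forms"
  shows "inverse_semigrp S"
  by (rule S.inverse_semigrpI[where C = band])
    (use assms normal_form_inverse in \<open>auto intro: band_commute\<close>)

end

text \<open>The axioms for p equate p(s)p(t) and p(st) only after multiplication by p(t') or p(s'),
  while q need not preserve products. With a = p(t), however, q(x) q(a') = q(xa') q(a) q(a'), where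
  a' is the inverse of a in H. So the left side depends on x only through xa', and the axiom for p
  can be used inside q. The other side is symmetric.\<close>

lemma compose_in_PHom:
  assumes G: "inverse_semigrp G" and H: "inverse_semigrp H" and K: "semigrp K"
    and p: "p \<in> PHom G H" and q: "q \<in> PHom H K"
  shows "comp_mor G q p \<in> PHom G K"
proof -
  interpret H: inverse_semigrp H by fact
  interpret p: partial_hom G H p by (intro partial_hom.intro partial_hom_axioms.intro H.semigrp_axioms assms)
  interpret q: partial_hom H K q by (intro partial_hom.intro partial_hom_axioms.intro assms)
  \<comment> \<open>Here the middle object has to be inverse: p(s') is an inverse of p(s), and
    uniqueness makes it the one that the axioms for q refer to.\<close>
  have star: "p (star G s) = star H (p s)" if "s \<in> carrier G" for s
    using H.star_unique p.p_star_is_inverse that p.p_closed by metis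
  have right_aux: "q (p s \<cdot>\<^bsub>H\<^esub> p t) \<cdot>\<^bsub>K\<^esub> q (p (star G t)) = q (p (s \<cdot>\<^bsub>G\<^esub> t)) \<cdot>\<^bsub>K\<^esub> q (p (star G t))"
    if s: "s \<in> carrier G" and t: "t \<in> carrier G" for s t
  proof -
    have c: "p s \<cdot>\<^bsub>H\<^esub> p t \<in> carrier H" "p (s \<cdot>\<^bsub>G\<^esub> t) \<in> carrier H" "p (star G t) \<in> carrier H"
      using s t by (simp_all add: H.closed p.G.closed)
    have "q x \<cdot>\<^bsub>K\<^esub> q (p (star G t)) =
        q (x \<cdot>\<^bsub>H\<^esub> p (star G t)) \<cdot>\<^bsub>K\<^esub> q (p t) \<cdot>\<^bsub>K\<^esub> q (p (star G t))" if x: "x \<in> carrier H" for x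
    proof -
      have "q x \<cdot>\<^bsub>K\<^esub> q (p (star G t)) =
          q x \<cdot>\<^bsub>K\<^esub> (q (star H (p t)) \<cdot>\<^bsub>K\<^esub> q (p t) \<cdot>\<^bsub>K\<^esub> q (star H (p t)))"
        using q.p_regular[of "star H (p t)"] t by (simp add: star)
      also have "\<dots> = q x \<cdot>\<^bsub>K\<^esub> q (star H (p t)) \<cdot>\<^bsub>K\<^esub> q (p t) \<cdot>\<^bsub>K\<^esub> q (star H (p t))"
        using x t by (simp add: q.S.assoc q.S.closed)
      finally show ?thesis
        using q.p_mult_right[OF x, of "star H (p t)"] t by (simp add: star)
    qed
    from this[OF c(1)] this[OF c(2)] show ?thesis
      using p.p_mult_right[OF s t] by simp
  qed
  have left_aux: "q (p (star G s)) \<cdot>\<^bsub>K\<^esub> q (p s \<cdot>\<^bsub>H\<^esub> p t) = q (p (star G s)) \<cdot>\<^bsub>K\<^esub> q (p (s \<cdot>\<^bsub>G\<^esub> t))"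
    if s: "s \<in> carrier G" and t: "t \<in> carrier G" for s t
  proof -
    have c: "p s \<cdot>\<^bsub>H\<^esub> p t \<in> carrier H" "p (s \<cdot>\<^bsub>G\<^esub> t) \<in> carrier H"
      using s t by (simp_all add: H.closed p.G.closed)
    have "q (p (star G s)) \<cdot>\<^bsub>K\<^esub> q x =
        q (p (star G s)) \<cdot>\<^bsub>K\<^esub> (q (p s) \<cdot>\<^bsub>K\<^esub> q (p (star G s) \<cdot>\<^bsub>H\<^esub> x))" if x: "x \<in> carrier H" for x
    proof -
      have "q (p (star G s)) \<cdot>\<^bsub>K\<^esub> q x =
          q (star H (p s)) \<cdot>\<^bsub>K\<^esub> q (p s) \<cdot>\<^bsub>K\<^esub> q (star H (p s)) \<cdot>\<^bsub>K\<^esub> q x"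
        using q.p_regular[of "star H (p s)"] s by (simp add: star)
      also have "\<dots> = q (star H (p s)) \<cdot>\<^bsub>K\<^esub> (q (p s) \<cdot>\<^bsub>K\<^esub> q (star H (p s)) \<cdot>\<^bsub>K\<^esub> q x)"
        using x s by (simp add: q.S.assoc q.S.closed)
      finally show ?thesis
        using q.p_mult_left[of "star H (p s)", OF _ x] s by (simp add: star)
    qed
    from this[OF c(1)] this[OF c(2)] show ?thesis
      using p.p_mult_left[OF s t] s t by (simp flip: H.assoc)
  qed
  have qr: "q (p s) \<cdot>\<^bsub>K\<^esub> q (p t) \<cdot>\<^bsub>K\<^esub> q (p (star G t)) = q (p s \<cdot>\<^bsub>H\<^esub> p t) \<cdot>\<^bsub>K\<^esub> q (p (star G t))"
    and ql: "q (p (star G s)) \<cdot>\<^bsub>K\<^esub> q (p s) \<cdot>\<^bsub>K\<^esub> q (p t) = q (p (star G s)) \<cdot>\<^bsub>K\<^esub> q (p s \<cdot>\<^bsub>H\<^esub> p t)"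
    and qreg: "q (p s) \<cdot>\<^bsub>K\<^esub> q (p (star G s)) \<cdot>\<^bsub>K\<^esub> q (p s) = q (p s)"
    if "s \<in> carrier G" "t \<in> carrier G" for s t
    using that by (simp_all add: star q.p_mult_left q.p_mult_right q.p_regular)
  show ?thesis
    unfolding PHom_def
    by (auto simp: compose_def p.G.closed qr ql qreg left_aux right_aux)
qed

section \<open>Presented semigroups\<close>

lemma words_append: "u \<in> words X \<Longrightarrow> v \<in> words X \<Longrightarrow> u @ v \<in> words X"
  by (auto simp: words_def)

lemma words_induct [consumes 1, case_names single Cons]:
  assumes "w \<in> words X" "\<And>x. x \<in> X \<Longrightarrow> P [x]"
    and "\<And>x w. x \<in> X \<Longrightarrow> w \<in> words X \<Longrightarrow> P w \<Longrightarrow> P (x # w)"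
  shows "P w"
  using assms(1)
proof (induction w)
  case (Cons x w)
  then show ?case using assms(2,3) by (cases "w = []") (auto simp: words_def)
qed (simp add: words_def)

lemma generated_cong_words: "(u, v) \<in> generated_cong X R \<Longrightarrow> u \<in> words X \<and> v \<in> words X"
  by (induction rule: generated_cong.induct) (auto simp: words_append)

lemma equiv_generated_cong: "equiv (words X) (generated_cong X R)"
proof (rule equivI)
  show "generated_cong X R \<subseteq> words X \<times> words X" by (auto dest: generated_cong_words)
  show "refl_on (words X) (generated_cong X R)"
    by (auto intro!: refl_onI generated_cong.refl)
  show "sym (generated_cong X R)" by (auto intro: symI generated_cong.sym)
  show "trans (generated_cong X R)" by (auto intro: transI generated_cong.trans)
qed

abbreviation wclass where "wclass X R w \<equiv> generated_cong X R `` {w}"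

lemma wclass_eq_iff:
  "u \<in> words X \<Longrightarrow> v \<in> words X \<Longrightarrow> wclass X R u = wclass X R v \<longleftrightarrow> (u, v) \<in> generated_cong X R"
  using eq_equiv_class_iff[OF equiv_generated_cong] .

lemma carrier_presented: "carrier (presented X R) = wclass X R ` words X"
  by (auto simp: presented_def quotient_def)

lemma wclass_mult:
  assumes u: "u \<in> words X" and v: "v \<in> words X"
  shows "wclass X R u \<cdot>\<^bsub>presented X R\<^esub> wclass X R v = wclass X R (u @ v)"
proof -
  have "wclass X R (a @ b) = wclass X R (u @ v)"
    if "(u, a) \<in> generated_cong X R" "(v, b) \<in> generated_cong X R" for a b
  proof -
    have w: "a \<in> words X" "b \<in> words X" using that generated_cong_words by blast+
    have "(u @ v, a @ b) \<in> generated_cong X R"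
      using that w u v by (meson generated_cong.trans generated_cong.left generated_cong.right)
    then show ?thesis using w u v by (metis wclass_eq_iff words_append)
  qed
  then have "(\<Union>a\<in>wclass X R u. \<Union>b\<in>wclass X R v. wclass X R (a @ b)) = wclass X R (u @ v)"
    using generated_cong.refl[OF u, of R] generated_cong.refl[OF v, of R] by blast
  then show ?thesis by (simp add: presented_def)
qed

lemma semigrp_presented: "semigrp (presented X R)"
  by unfold_locales (auto simp: carrier_presented wclass_mult words_append)

text \<open>A semigroup need not have a unit to assign to the empty word, so the recursion starts at
  one-letter words and [] gets a default value.\<close>

fun weval :: "('b, 'm) semigrp_scheme \<Rightarrow> ('a \<Rightarrow> 'b) \<Rightarrow> 'a list \<Rightarrow> 'b" where
  "weval H f [] = undefined"
| "weval H f [x] = f x"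
| "weval H f (x # y # w) = f x \<cdot>\<^bsub>H\<^esub> weval H f (y # w)"

lemma weval_Cons: "w \<in> words X \<Longrightarrow> weval H f (x # w) = f x \<cdot>\<^bsub>H\<^esub> weval H f w"
  by (cases w) (auto simp: words_def)

context semigrp
begin

lemma weval_closed: "w \<in> words X \<Longrightarrow> f \<in> X \<rightarrow> carrier S \<Longrightarrow> weval S f w \<in> carrier S"
  by (induction rule: words_induct) (auto simp: weval_Cons intro!: closed)

lemma weval_append:
  assumes "u \<in> words X" "v \<in> words X" "f \<in> X \<rightarrow> carrier S"
  shows "weval S f (u @ v) = weval S f u \<cdot> weval S f v"
  using assms
proof (induction rule: words_induct)
  case (single x)
  then show ?case by (simp add: weval_Cons)
next
  case (Cons x w)
  then have "f x \<in> carrier S" by auto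
  with Cons show ?case
    using weval_closed[of _ X f] by (simp add: weval_Cons[of _ X] words_append assoc)
qed

lemma weval_cong:
  assumes "(u, v) \<in> generated_cong X R" "f \<in> X \<rightarrow> carrier S"
    and "\<And>u v. (u, v) \<in> R \<Longrightarrow> u \<in> words X \<Longrightarrow> v \<in> words X \<Longrightarrow> weval S f u = weval S f v"
  shows "weval S f u = weval S f v"
  using assms(1)
proof (induction rule: generated_cong.induct)
  case (left u v w)
  then show ?case using assms(2) by (simp add: generated_cong_words weval_append[of _ X])
next
  case (right u v w)
  then show ?case using assms(2) by (simp add: generated_cong_words weval_append[of _ X])
qed (use assms in auto)

text \<open>The existence half of the universal property of a presentation;
  \<open>presented_hom_eqI\<close> is the uniqueness half.\<close>

lemma presented_hom_exists:
  assumes f: "f \<in> X \<rightarrow> carrier S"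
    and R: "\<And>u v. (u, v) \<in> R \<Longrightarrow> u \<in> words X \<Longrightarrow> v \<in> words X \<Longrightarrow> weval S f u = weval S f v"
  shows "\<exists>h \<in> Hom (presented X R) S. \<forall>x\<in>X. h (wclass X R [x]) = f x"
proof -
  \<comment> \<open>Evaluation is constant on congruence classes, so any chosen representative will
    do; the restriction to the carrier makes h extensional.\<close>
  define h where
    "h = (\<lambda>A\<in>carrier (presented X R). weval S f (SOME w. w \<in> A))"
  have h: "h (wclass X R w) = weval S f w" if w: "w \<in> words X" for w
  proof -
    have "(SOME v. v \<in> wclass X R w) \<in> wclass X R w"
      using generated_cong.refl[OF w] by (intro someI) auto
    then have "weval S f w = weval S f (SOME v. v \<in> wclass X R w)"
      using weval_cong[OF _ f R] by blast
    then show ?thesis using w by (simp add: h_def carrier_presented)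
  qed
  have "h \<in> Hom (presented X R) S"
    unfolding Hom_def
  proof (intro CollectI conjI PiE_I ballI)
    fix A B assume "A \<in> carrier (presented X R)" "B \<in> carrier (presented X R)"
    then show "h (A \<cdot>\<^bsub>presented X R\<^esub> B) = h A \<cdot> h B"
      by (auto simp: carrier_presented wclass_mult h words_append weval_append[OF _ _ f])
  next
    fix A assume "A \<in> carrier (presented X R)"
    then show "h A \<in> carrier S" by (auto simp: carrier_presented h intro: weval_closed[OF _ f])
  qed (simp add: h_def)
  moreover have "\<forall>x\<in>X. h (wclass X R [x]) = f x"
    using h by (simp add: words_def)
  ultimately show ?thesis by blast
qed

end

lemma presented_hom_eqI:
  assumes f: "f \<in> Hom (presented X R) H" and g: "g \<in> Hom (presented X R) H"
    and eq: "\<And>x. x \<in> X \<Longrightarrow> f (wclass X R [x]) = g (wclass X R [x])"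
  shows "f = g"
proof (rule extensionalityI[OF Hom_extensional[OF f] Hom_extensional[OF g]])
  have "f (wclass X R w) = g (wclass X R w)" if "w \<in> words X" for w
    using that
  proof (induction rule: words_induct)
    case (Cons x w)
    have x: "[x] \<in> words X" using Cons by (simp add: words_def)
    have "wclass X R (x # w) = wclass X R [x] \<cdot>\<^bsub>presented X R\<^esub> wclass X R w"
      using wclass_mult[OF x] Cons by simp
    then show ?case
      using Cons x Hom_mult[OF f] Hom_mult[OF g] eq by (simp add: carrier_presented)
  qed (use eq in blast)
  then show "f A = g A" if "A \<in> carrier (presented X R)" for A
    using that by (auto simp: carrier_presented)
qed

section \<open>The semigroup Pr(G)\<close>

lemma semigrp_Pr: "semigrp (Pr G)"
  by (simp add: Pr_def semigrp_presented)

lemma gen_closed: "g \<in> carrier G \<Longrightarrow> gen G g \<in> carrier (Pr G)"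
  by (simp add: gen_def Pr_def carrier_presented words_def)

lemma unit_apply: "g \<in> carrier G \<Longrightarrow> \<iota> G g = gen G g"
  by (simp add: unit_map_def)

lemma Pr_hom_eqI:
  assumes "f \<in> Hom (Pr G) H" "f' \<in> Hom (Pr G) H"
    and "\<And>g. g \<in> carrier G \<Longrightarrow> f (gen G g) = f' (gen G g)"
  shows "f = f'"
  using presented_hom_eqI[of f "carrier G" "pr_rels G" H f'] assms by (simp add: Pr_def gen_def)

text \<open>The three families in \<open>pr_rels\<close> are the three axioms of a partial
  homomorphism, read on classes of one-letter words.\<close>

lemma unit_in_PHom:
  assumes "inverse_semigrp G"
  shows "\<iota> G \<in> PHom G (Pr G)"
proof -
  interpret G: inverse_semigrp G by fact
  let ?X = "carrier G" and ?R = "pr_rels G"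
  have rel: "wclass ?X ?R u = wclass ?X ?R v" if "(u, v) \<in> ?R" "u \<in> words ?X" "v \<in> words ?X" for u v
    using that by (simp add: wclass_eq_iff generated_cong.base)
  note [simp] = wclass_mult words_def G.closed
  have 1: "wclass ?X ?R [s, t, star G t] = wclass ?X ?R [s \<cdot>\<^bsub>G\<^esub> t, star G t]"
    and 2: "wclass ?X ?R [star G s, s, t] = wclass ?X ?R [star G s, s \<cdot>\<^bsub>G\<^esub> t]"
    and 3: "wclass ?X ?R [s, star G s, s] = wclass ?X ?R [s]"
    if "s \<in> ?X" "t \<in> ?X" for s t
    using that by (intro rel; auto simp: pr_rels_def)+
  show ?thesis
    using gen_closed[of _ G]
    by (auto simp: PHom_def unit_map_def gen_def Pr_def 1 2 3)
qed

lemma inverse_semigrp_Pr: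
  assumes "inverse_semigrp G"
  shows "inverse_semigrp (Pr G)"
proof -
  interpret G: inverse_semigrp G by fact
  interpret \<iota>: partial_hom G "Pr G" "\<iota> G"
    by (intro partial_hom.intro partial_hom_axioms.intro assms semigrp_Pr unit_in_PHom)
  show ?thesis
  proof (rule \<iota>.inverse_semigrp_of_generated)
    have "wclass (carrier G) (pr_rels G) w \<in> \<iota>.normal_forms" if "w \<in> words (carrier G)" for w
      using that
    proof (induction rule: words_induct)
      case (single s)
      then show ?case using \<iota>.p_normal_form[of s] by (simp add: unit_apply gen_def)
    next
      case (Cons s w)
      then show ?case
        using \<iota>.p_mult_normal_form[of s "wclass (carrier G) (pr_rels G) w"]
          wclass_mult[of "[s]" "carrier G" w "pr_rels G"]
        by (simp add: unit_apply gen_def Pr_def words_def)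
    qed
    then show "carrier (Pr G) \<subseteq> \<iota>.normal_forms"
      by (auto simp: Pr_def carrier_presented)
  qed
qed

lemma Pr_universal:
  assumes G: "inverse_semigrp G" and H: "semigrp H" and p: "p \<in> PHom G H"
  shows "\<exists>!f. f \<in> Hom (Pr G) H \<and> (\<forall>g\<in>carrier G. f (gen G g) = p g)"
proof -
  interpret partial_hom G H p
    by (intro partial_hom.intro partial_hom_axioms.intro assms)
  have "\<exists>f\<in>Hom (presented (carrier G) (pr_rels G)) H.
      \<forall>g\<in>carrier G. f (wclass (carrier G) (pr_rels G) [g]) = p g"
  proof (rule S.presented_hom_exists)
    fix u v assume "(u, v) \<in> pr_rels G"
    \<comment> \<open>\<open>weval\<close> brackets to the right and the axioms to the left, so the
      two are matched by reassociating.\<close>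
    then show "weval H p u = weval H p v"
      using p_mult_left p_mult_right p_regular by (auto simp: pr_rels_def simp flip: S.assoc)
  qed simp
  then show ?thesis
    using Pr_hom_eqI[of _ G H] by (auto simp: Pr_def gen_def)
qed

section \<open>The adjunction\<close>

lemma adj_apply: "g \<in> carrier G \<Longrightarrow> \<Phi> G f g = f (gen G g)"
  by (simp add: adj_def compose_def unit_map_def)

text \<open>Invertibility of Pr(G) enters twice: f is a partial homomorphism because its domain is
  inverse, and composites are partial homomorphisms when the middle object is inverse.\<close>

lemma adj_in_PHom:
  assumes "inverse_semigrp G" "semigrp H" "f \<in> Hom (Pr G) H"
  shows "\<Phi> G f \<in> PHom G H"
  unfolding adj_def
  using assms Hom_subset_PHom[OF inverse_semigrp_Pr]
  by (intro compose_in_PHom[OF _ inverse_semigrp_Pr _ unit_in_PHom]) auto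

text \<open>Injectivity is agreement on generators, surjectivity the existence part of
  \<open>Pr_universal\<close>.\<close>

lemma bij_betw_adj:
  assumes "inverse_semigrp G" "semigrp H"
  shows "bij_betw (\<Phi> G) (Hom (Pr G) H) (PHom G H)"
proof (rule bij_betw_imageI)
  show "inj_on (\<Phi> G) (Hom (Pr G) H)"
    by (rule inj_onI) (metis Pr_hom_eqI adj_apply)
  show "\<Phi> G ` Hom (Pr G) H = PHom G H"
  proof (intro equalityI subsetI)
    fix p assume p: "p \<in> PHom G H"
    obtain f where f: "f \<in> Hom (Pr G) H" "\<forall>g\<in>carrier G. f (gen G g) = p g"
      using Pr_universal[OF assms p] by blast
    have "\<Phi> G f = p"
      using f PHom_extensional[OF p] PHom_extensional[OF adj_in_PHom[OF assms f(1)]]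
      by (intro extensionalityI) (auto simp: adj_apply)
    with f show "p \<in> \<Phi> G ` Hom (Pr G) H" by blast
  qed (use adj_in_PHom[OF assms] in auto)
qed

text \<open>The universal property applied to p followed by \<iota> H; it justifies the definite
  description in \<open>Pr_map\<close>.\<close>

lemma Pr_map_ex1:
  assumes "inverse_semigrp G" "inverse_semigrp H" "p \<in> PHom G H"
  shows "\<exists>!f. f \<in> Hom (Pr G) (Pr H) \<and> (\<forall>g\<in>carrier G. f (gen G g) = gen H (p g))"
proof -
  have "comp_mor G (\<iota> H) p \<in> PHom G (Pr H)"
    using assms unit_in_PHom semigrp_Pr by (intro compose_in_PHom)
  from Pr_universal[OF assms(1) semigrp_Pr this] show ?thesis
    using PHom_closed[OF assms(3)] by (simp add: compose_def unit_map_def)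
qed

lemma Pr_map:
  assumes "inverse_semigrp G" "inverse_semigrp H" "p \<in> PHom G H"
  shows Pr_map_in_Hom: "Pr_map G H p \<in> Hom (Pr G) (Pr H)"
    and Pr_map_gen: "g \<in> carrier G \<Longrightarrow> Pr_map G H p (gen G g) = gen H (p g)"
  using theI'[OF Pr_map_ex1[OF assms]] by (auto simp: Pr_map_def)

lemma ident_in_PHom: "inverse_semigrp G \<Longrightarrow> ident G \<in> PHom G G"
  using Hom_subset_PHom ident_in_Hom inverse_semigrp.axioms(1) by blast

lemma counit_ex1:
  assumes "inverse_semigrp G"
  shows "\<exists>!f. f \<in> Hom (Pr G) G \<and> (\<forall>g\<in>carrier G. f (gen G g) = g)"
  using Pr_universal[OF assms inverse_semigrp.axioms(1)[OF assms] ident_in_PHom[OF assms]]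
  by (simp add: ident_def)

lemma counit:
  assumes "inverse_semigrp G"
  shows counit_in_Hom: "\<partial> G \<in> Hom (Pr G) G"
    and counit_gen: "g \<in> carrier G \<Longrightarrow> \<partial> G (gen G g) = g"
  using theI'[OF counit_ex1[OF assms]] by (auto simp: counit_map_def)

theorem mainTheorem4:
  fixes G :: "'a semigrp" and G' :: "'b semigrp" and G'' :: "'c semigrp"
    and H :: "'d semigrp" and H' :: "'e semigrp"
  assumes "inverse_semigrp G" and "inverse_semigrp G'" and "inverse_semigrp G''"
    and "inverse_semigrp H" and "inverse_semigrp H'"
  shows
    \<comment> \<open>identities and composites in Inv and PInv; the functor Fg is the inclusion\<close>
    "ident G \<in> Hom G G \<and>
     (\<forall>f\<in>Hom G G'. \<forall>g\<in>Hom G' G''. comp_mor G g f \<in> Hom G G'') \<and>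
     (\<forall>p\<in>PHom G G'. \<forall>q\<in>PHom G' G''. comp_mor G q p \<in> PHom G G'') \<and>
     Hom G H \<subseteq> PHom G H \<and>

     \<comment> \<open>Pr is a functor from PInv to Inv\<close>
     inverse_semigrp (Pr G) \<and>
     (\<forall>p\<in>PHom G G'. \<exists>!f. f \<in> Hom (Pr G) (Pr G') \<and> (\<forall>g\<in>carrier G. f (gen G g) = gen G' (p g))) \<and>
     (\<forall>p\<in>PHom G G'. Pr_map G G' p \<in> Hom (Pr G) (Pr G') \<and>
        (\<forall>g\<in>carrier G. Pr_map G G' p (gen G g) = gen G' (p g))) \<and>
     Pr_map G G (ident G) = ident (Pr G) \<and>
     (\<forall>p\<in>PHom G G'. \<forall>q\<in>PHom G' G''.
        Pr_map G G'' (comp_mor G q p) = comp_mor (Pr G) (Pr_map G' G'' q) (Pr_map G G' p)) \<and>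

     \<comment> \<open>the bijection, natural in the first argument (along p) and in the second (along h)\<close>
     bij_betw (\<Phi> G) (Hom (Pr G) H) (PHom G H) \<and>
     (\<forall>p\<in>PHom G' G. \<forall>f\<in>Hom (Pr G) H.
        \<Phi> G' (comp_mor (Pr G') f (Pr_map G' G p)) = comp_mor G' (\<Phi> G f) p) \<and>
     (\<forall>h\<in>Hom H H'. \<forall>f\<in>Hom (Pr G) H.
        \<Phi> G (comp_mor (Pr G) h f) = comp_mor G h (\<Phi> G f)) \<and>

     \<comment> \<open>the unit: a natural transformation from the identity of PInv to Fg Pr\<close>
     \<iota> G \<in> PHom G (Pr G) \<and>
     (\<forall>p\<in>PHom G G'. comp_mor G (Pr_map G G' p) (\<iota> G) = comp_mor G (\<iota> G') p) \<and>
     \<Phi> G (ident (Pr G)) = \<iota> G \<and>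

     \<comment> \<open>the counit: a natural transformation from Pr Fg to the identity of Inv\<close>
     (\<exists>!f. f \<in> Hom (Pr G) G \<and> (\<forall>g\<in>carrier G. f (gen G g) = g)) \<and>
     \<partial> G \<in> Hom (Pr G) G \<and> (\<forall>g\<in>carrier G. \<partial> G (gen G g) = g) \<and>
     (\<forall>h\<in>Hom G G'. comp_mor (Pr G) h (\<partial> G) = comp_mor (Pr G) (\<partial> G') (Pr_map G G' h)) \<and>
     \<Phi> G (\<partial> G) = ident G \<and>

     \<comment> \<open>the inverse bijection in terms of the counit, and the triangle identities\<close>
     (\<forall>p\<in>PHom G H. inv_into (Hom (Pr G) H) (\<Phi> G) p = comp_mor (Pr G) (\<partial> H) (Pr_map G H p)) \<and>
     comp_mor (Pr G) (\<partial> (Pr G)) (Pr_map G (Pr G) (\<iota> G)) = ident (Pr G) \<and>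
     comp_mor G (\<partial> G) (\<iota> G) = ident G"
proof -
  note inv = assms
  note sg = assms[THEN inverse_semigrp.axioms(1)]
  note [simp] = Pr_map_gen counit_gen unit_apply adj_apply gen_closed PHom_closed Hom_closed compose_eq
  have Hom_PHom: "h \<in> Hom G G' \<Longrightarrow> h \<in> PHom G G'" for h
    using Hom_subset_PHom[OF inv(1) sg(2)] by blast
  have comp_PHom: "comp_mor G q p \<in> PHom G G''" if "p \<in> PHom G G'" "q \<in> PHom G' G''" for p q
    using compose_in_PHom[OF inv(1,2) sg(3)] that by blast
  \<comment> \<open>Maps out of Pr(G) are compared on generators once both sides are known to be
    homomorphisms; maps out of G are compared pointwise, using extensionality.\<close>
  have Pr_ident: "Pr_map G G (ident G) = ident (Pr G)"
    by (rule Pr_hom_eqI[of _ G "Pr G"])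
      (use inv in \<open>auto intro: Pr_map_in_Hom ident_in_PHom ident_in_Hom semigrp_Pr simp: ident_in_PHom ident_apply\<close>)
  have Pr_comp: "Pr_map G G'' (comp_mor G q p) = comp_mor (Pr G) (Pr_map G' G'' q) (Pr_map G G' p)"
    if "p \<in> PHom G G'" "q \<in> PHom G' G''" for p q
    by (rule Pr_hom_eqI[of _ G "Pr G''"])
      (use inv that comp_PHom[OF that] in \<open>auto intro!: Pr_map_in_Hom compose_in_Hom semigrp_Pr\<close>)
  have nat_left: "\<Phi> G' (comp_mor (Pr G') f (Pr_map G' G p)) = comp_mor G' (\<Phi> G f) p"
    if "p \<in> PHom G' G" for p f
    by (rule extensionalityI[of _ "carrier G'"]) (use inv that in \<open>auto simp: adj_def\<close>)
  have nat_right: "\<Phi> G (comp_mor (Pr G) h f) = comp_mor G h (\<Phi> G f)" for h f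
    by (rule extensionalityI[of _ "carrier G"]) (auto simp: adj_def)
  have unit_nat: "comp_mor G (Pr_map G G' p) (\<iota> G) = comp_mor G (\<iota> G') p" if "p \<in> PHom G G'" for p
    by (rule extensionalityI[of _ "carrier G"]) (use inv that in auto)
  have adj_ident: "\<Phi> G (ident (Pr G)) = \<iota> G"
    by (rule extensionalityI[of _ "carrier G"]) (auto simp: adj_def unit_map_def ident_def)
  have counit_nat: "comp_mor (Pr G) h (\<partial> G) = comp_mor (Pr G) (\<partial> G') (Pr_map G G' h)"
    if "h \<in> Hom G G'" for h
    by (rule Pr_hom_eqI[of _ G G'])
      (use inv that Hom_PHom[OF that] in \<open>auto intro!: compose_in_Hom semigrp_Pr counit_in_Hom Pr_map_in_Hom\<close>)
  have adj_counit: "\<Phi> G (\<partial> G) = ident G"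
    by (rule extensionalityI[of _ "carrier G"]) (use inv in \<open>auto simp: adj_def ident_def\<close>)
  have inv_adj: "inv_into (Hom (Pr G) H) (\<Phi> G) p = comp_mor (Pr G) (\<partial> H) (Pr_map G H p)"
    if p: "p \<in> PHom G H" for p
  proof (rule inv_into_f_eq)
    show "inj_on (\<Phi> G) (Hom (Pr G) H)"
      using bij_betw_adj[OF inv(1) sg(4)] by (rule bij_betw_imp_inj_on)
    show "comp_mor (Pr G) (\<partial> H) (Pr_map G H p) \<in> Hom (Pr G) H"
      using inv p by (auto intro!: compose_in_Hom semigrp_Pr counit_in_Hom Pr_map_in_Hom)
    \<comment> \<open>At g the composite sends [g] to [p(g)] and then to p(g).\<close>
    show "\<Phi> G (comp_mor (Pr G) (\<partial> H) (Pr_map G H p)) = p"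
      by (rule extensionalityI[of _ "carrier G"])
        (use inv p PHom_extensional[OF p] in \<open>auto simp: adj_def\<close>)
  qed
  \<comment> \<open>On generators [g] goes to [[g]] and back to [g]; the counit at Pr(G) is
    available because Pr(G) is itself inverse.\<close>
  have triangle: "comp_mor (Pr G) (\<partial> (Pr G)) (Pr_map G (Pr G) (\<iota> G)) = ident (Pr G)"
    by (rule Pr_hom_eqI[of _ G "Pr G"])
      (use inv inverse_semigrp_Pr[OF inv(1)] unit_in_PHom[OF inv(1)] in
        \<open>auto intro!: compose_in_Hom ident_in_Hom semigrp_Pr counit_in_Hom Pr_map_in_Hom simp: ident_apply\<close>)
  \<comment> \<open>The last triangle identity is \<open>adj_counit\<close> with \<Phi>
    unfolded.\<close>
  show ?thesis
    by (intro conjI ballI)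
      (fact ident_in_Hom[OF sg(1)] inverse_semigrp_Pr[OF inv(1)] Pr_ident adj_ident adj_counit triangle
        unit_in_PHom[OF inv(1)] Hom_subset_PHom[OF inv(1) sg(4)] bij_betw_adj[OF inv(1) sg(4)]
        counit_ex1[OF inv(1)] counit_in_Hom[OF inv(1)] adj_counit[unfolded adj_def]
      | (erule (1) comp_PHom Pr_comp) | (erule unit_nat nat_left counit_nat inv_adj)
      | (rule nat_right) | (erule compose_in_Hom[OF sg(1)], assumption)
      | (erule Pr_map_ex1[OF inv(1,2)] Pr_map_in_Hom[OF inv(1,2)])
      | (erule (1) Pr_map_gen[OF inv(1,2)]) | (erule counit_gen[OF inv(1)]))+
qed

end
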